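(* Let $A\in\mathbb{C}^{q\times n}$, let $W\in\mathbb{C}^{n\times q}$ with $W\neq 0$, let $m$ be a positive integer and $k=\max\{\mathrm{Ind}(AW),\mathrm{Ind}(WA)\}$. Let $A^{\mathrm{wg}_m,W}\in\mathbb{C}^{q\times n}$ denote the $W$-weighted $m$-weak group inverse of $A$. Then: (1) $AWA^{\mathrm{wg}_m,W}W=P_{\mathcal{R}((AW)^{k}),\,\mathcal{N}\left(((WA)^{k})^*W(AW)^{m}\right)}$; (2) $WA^{\mathrm{wg}_m,W}WA=P_{\mathcal{R}((WA)^{k}),\,\mathcal{N}\left(((WA)^{k})^*(WA)^{m+1}\right)}$.
   Context: Notation: $B^*$ is the conjugate transpose, $\mathcal{R}(B)$ the range (column space), $\mathcal{N}(B)$ the null space. For square $B$, $B^0=I$ and $\mathrm{Ind}(B)$ is the smallest integer $j\ge 0$ with $\mathrm{rank}(B^{j})=\mathrm{rank}(B^{j+1})$. If $\mathbb{C}^p=\mathcal{T}\oplus\mathcal{S}$, $P_{\mathcal{T},\mathcal{S}}$ is the projector onto $\mathcal{T}$ along $\mathcal{S}$ (using this notation includes the assertion that the direct sum decomposition holds); $P_{\mathcal{T}}=P_{\mathcal{T},\mathcal{T}^\perp}$ is the orthogonal projector. $W$-product: for $X,Y\in\mathbb{C}^{q\times n}$, $X\star Y=XWY$, and $X^{\star l}=X\star\cdots\star X$ ($l$ factors) for $l\ge 1$. Weighted core-EP inverse: $A^{\mathrm{cEP},W}\in\mathbb{C}^{q\times n}$ is the unique matrix $X$ with $WAWX=P_{\mathcal{R}((WA)^k)}$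 and $\mathcal{R}(X)\subseteq\mathcal{R}((AW)^k)$, where $k=\max\{\mathrm{Ind}(AW),\mathrm{Ind}(WA)\}$ (existence and uniqueness are known). $W$-weighted $m$-weak group inverse: $A^{\mathrm{wg}_m,W}=(A^{\mathrm{cEP},W})^{\star(m+1)}\,W\,A^{\star m}$. *)

theory Defs
  imports "HOL-Analysis.Analysis"
begin

text \<open>A \<open>q\<close> by \<open>n\<close> complex matrix has type \<^typ>\<open>complex^'n^'q\<close>.\<close>

definition conj_transpose :: "complex^'n^'m \<Rightarrow> complex^'m^'n" where
  "conj_transpose B = transpose (map_matrix cnj B)"

definition mat_range :: "complex^'n^'m \<Rightarrow> (complex^'m) set" where
  "mat_range B = range (\<lambda>x. B *v x)"

definition mat_null :: "complex^'n^'m \<Rightarrow> (complex^'n) set" where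
  "mat_null B = {x. B *v x = 0}"

text \<open>The power \<open>(^)\<close> of type \<^typ>\<open>complex^'n^'n\<close> in the library is entrywise.\<close>

primrec mat_pow :: "complex^'n^'n \<Rightarrow> nat \<Rightarrow> complex^'n^'n" where
  "mat_pow B 0 = mat 1"
| "mat_pow B (Suc j) = B ** mat_pow B j"

definition mat_index :: "complex^'n^'n \<Rightarrow> nat" where
  "mat_index B = (LEAST j. rank (mat_pow B j) = rank (mat_pow B (j + 1)))"

definition direct_sum_decomp :: "(complex^'p) set \<Rightarrow> (complex^'p) set \<Rightarrow> bool" where
  "direct_sum_decomp T S \<longleftrightarrow>
     vec.subspace T \<and> vec.subspace S \<and> T \<inter> S = {0} \<and> {t + s | t s. t \<in> T \<and> s \<in> S} = UNIV"

text \<open>Meaningful only if \<^term>\<open>direct_sum_decomp T S\<close> holds, which has to be asserted separately.\<close>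

definition projector :: "(complex^'p) set \<Rightarrow> (complex^'p) set \<Rightarrow> complex^'p^'p" where
  "projector T S = (THE P. \<forall>t\<in>T. \<forall>s\<in>S. P *v (t + s) = t)"

text \<open>The complement for the Hermitian inner product; the inner product of
  \<^typ>\<open>complex^'p\<close> in the library is its real part.\<close>

definition hermitian_comp :: "(complex^'p) set \<Rightarrow> (complex^'p) set" where
  "hermitian_comp T = {y. \<forall>x\<in>T. (\<Sum>i\<in>UNIV. cnj (x $ i) * y $ i) = 0}"

definition orth_projector :: "(complex^'p) set \<Rightarrow> complex^'p^'p" where
  "orth_projector T = projector T (hermitian_comp T)"

definition wprod :: "complex^'q^'n \<Rightarrow> complex^'n^'q \<Rightarrow> complex^'n^'q \<Rightarrow> complex^'n^'q" where
  "wprod W X Y = X ** W ** Y"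

text \<open>The product of \<open>l\<close> factors \<open>X\<close>, for \<open>l \<ge> 1\<close>; the value at \<open>l = 0\<close> carries no meaning.\<close>

definition wpow :: "complex^'q^'n \<Rightarrow> complex^'n^'q \<Rightarrow> nat \<Rightarrow> complex^'n^'q" where
  "wpow W X l = (wprod W X ^^ (l - 1)) X"

definition windex :: "complex^'q^'n \<Rightarrow> complex^'n^'q \<Rightarrow> nat" where
  "windex W A = max (mat_index (A ** W)) (mat_index (W ** A))"

definition weighted_core_EP :: "complex^'q^'n \<Rightarrow> complex^'n^'q \<Rightarrow> complex^'n^'q" where
  "weighted_core_EP W A = (THE X.
     W ** A ** W ** X = orth_projector (mat_range (mat_pow (W ** A) (windex W A))) \<and>
     mat_range X \<subseteq> mat_range (mat_pow (A ** W) (windex W A)))"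

definition weighted_weak_group :: "complex^'q^'n \<Rightarrow> nat \<Rightarrow> complex^'n^'q \<Rightarrow> complex^'n^'q" where
  "weighted_weak_group W m A = wpow W (weighted_core_EP W A) (m + 1) ** W ** wpow W A m"

end

theory Submission
  imports Defs
begin

text \<open>
  Write \<open>N = A ** W\<close>, \<open>M = W ** A\<close>, \<open>T\<close> for the range of \<open>N\<^sup>k\<close> and \<open>S\<close> for the range of
  \<open>M\<^sup>k\<close>. Since \<open>k\<close> is at least both indices, \<open>N\<close> permutes \<open>T\<close> and \<open>M\<close> permutes \<open>S\<close>
  (\<open>index_injective\<close>, \<open>index_image\<close>); as \<open>N\<close> and \<open>M\<close> are the two composites of \<open>W\<close> and
  \<open>A\<close>, the maps \<open>W : T \<rightarrow> S\<close> and \<open>A : S \<rightarrow> T\<close> are injective as well.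

  The key object is \<open>V = X ** W\<close>, where \<open>X\<close> is the weighted core-EP inverse. The equation
  defining \<open>X\<close> gives \<open>W N V = P W\<close> with \<open>P\<close> the orthogonal projector onto \<open>S\<close>. Hence \<open>V\<close>
  maps everything into \<open>T\<close>, is inverse to \<open>N\<close> on \<open>T\<close>, and kills exactly those \<open>x\<close> with
  \<open>(M\<^sup>k)\<^sup>* W x = 0\<close> (\<open>core_EP_weight\<close>).

  The weighted weak group inverse \<open>Y\<close> satisfies \<open>Y W = V\<^sup>m\<^sup>+\<^sup>1 N\<^sup>m\<close>, so that \<open>A W Y W = V\<^sup>m N\<^sup>m\<close>
  and \<open>W Y W A = W V\<^sup>m\<^sup>+\<^sup>1 N\<^sup>m A\<close>. The first matrix maps into \<open>T\<close> and fixes \<open>T\<close> pointwise, the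
  second does the same for \<open>S\<close>. Such a matrix is the projector along its own null space
  (\<open>projector_if_retraction\<close>). A power of \<open>V\<close> has the null space of \<open>V\<close>, and therefore the
  null spaces are given by \<open>(M\<^sup>k)\<^sup>* W N\<^sup>m x = 0\<close> and \<open>(M\<^sup>k)\<^sup>* W N\<^sup>m A x = 0\<close>, where
  \<open>W N\<^sup>m A = M\<^sup>m\<^sup>+\<^sup>1\<close>.
\<close>

section \<open>Range and null space\<close>

lemma mat_range_iff: "x \<in> mat_range B \<longleftrightarrow> (\<exists>y. x = B *v y)"
  by (auto simp: mat_range_def)

lemma mat_null_iff: "x \<in> mat_null B \<longleftrightarrow> B *v x = 0"
  by (simp add: mat_null_def)

lemma subspace_mat_range: "vec.subspace (mat_range B)"
  unfolding mat_range_def by (rule vec.subspace_image) (auto intro: vec.subspace_UNIV)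

lemma subspace_mat_null: "vec.subspace (mat_null B)"
  unfolding mat_null_def by (rule vec.subspace_kernel)

lemma matrix_vector_mult_axis: "(B *v axis j 1) $ i = B $ i $ j"
  for B :: "complex^'n^'m"
  by (simp add: matrix_vector_mult_def axis_def if_distrib cong: if_cong)

text \<open>Column \<open>j\<close> of \<open>D\<close> is a preimage under \<open>B\<close> of column \<open>j\<close> of \<open>C\<close>.\<close>

lemma matrix_mult_factor:
  fixes B :: "complex^'n^'m" and C :: "complex^'p^'m"
  assumes "mat_range C \<subseteq> mat_range B"
  obtains D where "C = B ** D"
proof -
  have "\<forall>j. \<exists>d. C *v axis j 1 = B *v d"
    using assms by (auto simp: mat_range_def)
  then obtain d where d: "\<And>j. C *v axis j 1 = B *v d j" by metis
  have "C = B ** (\<chi> i j. d j $ i)"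
  proof (simp add: vec_eq_iff, intro allI)
    fix i k
    have "C $ i $ k = (C *v axis k 1) $ i"
      by (simp add: matrix_vector_mult_axis)
    also have "\<dots> = (B ** (\<chi> i j. d j $ i)) $ i $ k"
      by (simp only: d) (simp add: matrix_matrix_mult_def matrix_vector_mult_def)
    finally show "C $ i $ k = (B ** (\<chi> i j. d j $ i)) $ i $ k" .
  qed
  then show thesis by (rule that)
qed

lemma row_matrix_mult: "row i (D ** B) = (\<Sum>l\<in>UNIV. D $ i $ l *s row l B)"
  by (simp add: vec_eq_iff row_def matrix_matrix_mult_def)

lemma span_rows_matrix_mult:
  fixes B :: "complex^'n^'m"
  shows "vec.span (rows (D ** B)) \<subseteq> vec.span (rows B)"
proof (rule vec.span_minimal)
  have "row i (D ** B) \<in> vec.span (rows B)" for i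
    unfolding row_matrix_mult
    by (intro vec.span_sum vec.span_scale vec.span_base) (auto simp: rows_def)
  then show "rows (D ** B) \<subseteq> vec.span (rows B)"
    by (auto simp: rows_def)
qed (rule vec.subspace_span)

lemma rank_mult_le:
  fixes B :: "complex^'n^'m"
  shows "rank (D ** B) \<le> rank B"
  using vec.dim_subset[OF span_rows_matrix_mult[of D B]]
  by (simp add: row_rank_def_gen)

text \<open>The rank is defined as the dimension of the row space, and left multiplication by \<open>D\<close> can only
  shrink the row space; equal ranks therefore give equal row spaces. A vector annihilated by all
  rows of one matrix is then annihilated by all rows of the other. Arguing with rows avoids the
  equality of row rank and column rank over the complex numbers.\<close>

lemma null_mult_if_rank_eq:
  fixes B :: "complex^'n^'m"
  assumes "rank (D ** B) = rank B" and "(D ** B) *v x = 0"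
  shows "B *v x = 0"
proof -
  let ?Z = "{v. (\<Sum>i\<in>UNIV. v $ i * x $ i) = 0}"
  have eq: "vec.span (rows (D ** B)) = vec.span (rows B)"
    using assms(1)
    by (intro vec.subspace_dim_equal span_rows_matrix_mult vec.subspace_span)
      (simp add: row_rank_def_gen)
  have Z: "vec.subspace ?Z"
    by (auto simp: vec.subspace_def algebra_simps sum.distrib simp flip: sum_distrib_left)
  have "rows (D ** B) \<subseteq> ?Z"
    using assms(2) by (auto simp: rows_def row_def vec_eq_iff matrix_vector_mult_def)
  then have "rows B \<subseteq> ?Z"
    using vec.span_minimal[OF _ Z] vec.span_superset[of "rows B"] eq by blast
  then show ?thesis
    by (auto simp: rows_def row_def vec_eq_iff matrix_vector_mult_def)
qed

section \<open>Powers and the index\<close>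

lemma mat_pow_add: "mat_pow B (i + j) = mat_pow B i ** mat_pow B j"
  by (induction i) (simp_all add: matrix_mul_assoc)

lemma mat_pow_Suc2: "mat_pow B (Suc j) = mat_pow B j ** B"
  using mat_pow_add[of B j 1] by simp

text \<open>Both sides are the same alternating product of \<open>A\<close> and \<open>W\<close>, bracketed differently. Exchanging
  the roles of \<open>A\<close> and \<open>W\<close> gives the mirror image.\<close>

lemma mat_pow_slide:
  "mat_pow (A ** W) j ** A = A ** mat_pow (W ** A) j"
proof (induction j)
  case (Suc j)
  have "mat_pow (A ** W) (Suc j) ** A = A ** W ** (mat_pow (A ** W) j ** A)"
    by (simp add: matrix_mul_assoc)
  then show ?case by (simp add: Suc matrix_mul_assoc)
qed simp

text \<open>The ranks of the powers decrease, so an exponent of minimal rank is one where the rank stabilises;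
  this makes the least number in the definition of the index exist.\<close>

lemma mat_index_rank:
  "rank (mat_pow B (Suc (mat_index B))) = rank (mat_pow B (mat_index B))"
proof -
  obtain j where j: "\<And>i. rank (mat_pow B j) \<le> rank (mat_pow B i)"
    using ex_has_least_nat[of "\<lambda>_. True" undefined "\<lambda>j. rank (mat_pow B j)"] by auto
  have "rank (mat_pow B j) = rank (mat_pow B (j + 1))"
    using j[of "j + 1"] rank_mult_le[of B "mat_pow B j"] by simp
  then show ?thesis
    unfolding mat_index_def by (rule LeastI2) simp
qed

text \<open>If \<open>B\<close> kills \<open>B\<^sup>k y\<close>, then \<open>B\<^sup>i y\<close> with \<open>i = k - mat_index B\<close> lies in the null space of
  one power past the index, which equals the null space of the power at the index.\<close>

lemma index_injective:
  assumes "mat_index B \<le> k" and "x \<in> mat_range (mat_pow B k)" and "B *v x = 0"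
  shows "x = 0"
proof -
  obtain i where k: "k = mat_index B + i" using assms(1) le_Suc_ex by blast
  obtain y where x: "x = mat_pow B k *v y" using assms(2) by (auto simp: mat_range_iff)
  have "(B ** mat_pow B (mat_index B)) *v (mat_pow B i *v y) = 0"
    using assms(3) by (simp add: x k mat_pow_add matrix_vector_mul_assoc matrix_mul_assoc)
  then have "mat_pow B (mat_index B) *v (mat_pow B i *v y) = 0"
    by (rule null_mult_if_rank_eq[rotated]) (use mat_index_rank[of B] in simp)
  then show ?thesis by (simp add: x k mat_pow_add matrix_vector_mul_assoc)
qed

lemma mult_mat_range_pow:
  assumes "x \<in> mat_range (mat_pow B k)"
  shows "B *v x \<in> mat_range (mat_pow B k)"
proof -
  obtain y where "x = mat_pow B k *v y" using assms by (auto simp: mat_range_iff)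
  then have "B *v x = mat_pow B k *v (B *v y)"
    using mat_pow_Suc2[of B k] by (simp add: matrix_vector_mul_assoc)
  then show ?thesis by (auto simp: mat_range_iff)
qed

text \<open>An injective linear map of a finite-dimensional space into itself is onto.\<close>

lemma index_image:
  assumes "mat_index B \<le> k"
  shows "(*v) B ` mat_range (mat_pow B k) = mat_range (mat_pow B k)"
proof (rule vec.subspace_dim_equal)
  let ?R = "mat_range (mat_pow B k)"
  have "inj_on ((*v) B) (vec.span ?R)"
    using index_injective[OF assms] subspace_mat_range[of "mat_pow B k"]
    by (subst vec.linear_inj_on_iff_eq_0) (auto simp: vec.span_eq_iff[THEN iffD2])
  then have "vec.dim ((*v) B ` ?R) = vec.dim ?R"
    by (intro vec.dim_image_eq) auto
  then show "vec.dim ?R \<le> vec.dim ((*v) B ` ?R)" by simp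
  show "vec.subspace ((*v) B ` ?R)"
    by (intro vec.subspace_image subspace_mat_range matrix_vector_mul_linear_gen)
  show "(*v) B ` ?R \<subseteq> ?R" using mult_mat_range_pow by blast
  show "vec.subspace ?R" by (rule subspace_mat_range)
qed

lemma mat_range_pow_shift:
  assumes "mat_index B \<le> k"
  shows "mat_range (mat_pow B (i + k)) = mat_range (mat_pow B k)"
proof (induction i)
  case (Suc i)
  have "mat_range (mat_pow B (Suc i + k)) = (*v) B ` mat_range (mat_pow B (i + k))"
    by (auto simp: mat_range_def matrix_vector_mul_assoc image_image)
  then show ?case using Suc index_image[OF assms] by simp
qed simp

section \<open>Projectors\<close>

lemma direct_sum_decompE:
  assumes "direct_sum_decomp T S"
  obtains t s where "t \<in> T" "s \<in> S" "x = t + s"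
  using assms unfolding direct_sum_decomp_def by blast

lemma projector_eqI:
  assumes "direct_sum_decomp T S" and "\<And>t s. t \<in> T \<Longrightarrow> s \<in> S \<Longrightarrow> Q *v (t + s) = t"
  shows "projector T S = Q"
  unfolding projector_def
proof (rule the_equality)
  fix P assume "\<forall>t\<in>T. \<forall>s\<in>S. P *v (t + s) = t"
  then have "P *v x = Q *v x" for x
    using assms by (metis direct_sum_decompE)
  then show "P = Q" by (simp add: matrix_eq)
qed (use assms in auto)

text \<open>A projector is defined by description, so a matrix with its property has to be produced: column
  \<open>j\<close> is the \<open>T\<close>-component of the \<open>j\<close>-th unit vector.\<close>

lemma projector_add:
  fixes T S :: "(complex^'p) set"
  assumes ds: "direct_sum_decomp T S" and "t \<in> T" "s \<in> S"
  shows "projector T S *v (t + s) = t"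
proof -
  have T: "vec.subspace T" and S: "vec.subspace S" and TS: "T \<inter> S = {0}"
    using ds by (auto simp: direct_sum_decomp_def)
  have "\<forall>j. \<exists>t. t \<in> T \<and> axis j 1 - t \<in> S"
    using direct_sum_decompE[OF ds] by (metis add_diff_cancel_left')
  then obtain c where c: "\<And>j. c j \<in> T" "\<And>j. axis j 1 - c j \<in> S" by metis
  define P :: "complex^'p^'p" where "P = (\<chi> i j. c j $ i)"
  have P: "P *v x = (\<Sum>j\<in>UNIV. x $ j *s c j)" for x
    by (simp add: matrix_mult_sum P_def column_def)
  have PT: "P *v x \<in> T" for x
    unfolding P by (intro vec.subspace_sum vec.subspace_scale T c)
  have "x - P *v x = (\<Sum>j\<in>UNIV. x $ j *s (axis j 1 - c j))" for x
    unfolding P basis_expansion[of x, symmetric, THEN arg_cong, of "\<lambda>y. y - _"]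
    by (simp add: basis_expansion vec.scale_right_diff_distrib sum_subtractf)
  then have PS: "x - P *v x \<in> S" for x
    by (simp only:) (intro vec.subspace_sum vec.subspace_scale S c)
  have P_eq: "P *v (t + s) = t" if "t \<in> T" "s \<in> S" for t s
  proof -
    have "P *v (t + s) - t \<in> T" using PT that(1) vec.subspace_diff[OF T] by blast
    moreover have "P *v (t + s) - t = s - ((t + s) - P *v (t + s))" by simp
    then have "P *v (t + s) - t \<in> S" using PS that(2) vec.subspace_diff[OF S] by metis
    ultimately have "P *v (t + s) - t \<in> {0}" unfolding TS[symmetric] by (rule IntI)
    then show ?thesis by simp
  qed
  show ?thesis
    by (simp only: projector_eqI[OF ds P_eq] P_eq[OF assms(2,3)])
qed

text \<open>Every \<open>x\<close> splits as \<open>Q x + (x - Q x)\<close>, and \<open>Q\<close> kills the second summand because it fixes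
  \<open>Q x\<close>. This reduces both halves of the theorem to the computation of a null space.\<close>

lemma projector_if_retraction:
  assumes range: "\<And>x. Q *v x \<in> T" and fixed: "\<And>t. t \<in> T \<Longrightarrow> Q *v t = t"
  shows "direct_sum_decomp T (mat_null Q) \<and> Q = projector T (mat_null Q)"
proof -
  have T: "T = mat_range Q"
    using assms unfolding mat_range_def
    by (metis (mono_tags, lifting) rangeE rangeI subsetI subset_antisym)
  have "x \<in> {t + s |t s. t \<in> T \<and> s \<in> mat_null Q}" for x
  proof -
    have "x - Q *v x \<in> mat_null Q"
      by (simp add: mat_null_iff matrix_vector_mult_diff_distrib fixed range)
    then show ?thesis using range[of x] by force
  qed
  moreover have "T \<inter> mat_null Q = {0}"
    using fixed subspace_mat_range[of Q] by (auto simp: mat_null_iff T vec.subspace_0)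
  ultimately have ds: "direct_sum_decomp T (mat_null Q)"
    unfolding direct_sum_decomp_def using subspace_mat_range[of Q] subspace_mat_null[of Q]
    by (auto simp: T)
  then show ?thesis
    by (auto intro!: projector_eqI[symmetric]
        simp: matrix_vector_right_distrib fixed mat_null_iff)
qed

lemma hermitian_comp_mat_range: "hermitian_comp (mat_range B) = mat_null (conj_transpose B)"
proof (intro equalityI subsetI)
  fix y assume y: "y \<in> hermitian_comp (mat_range B)"
  have "(\<Sum>i\<in>UNIV. cnj ((B *v axis j 1) $ i) * y $ i) = 0" for j
    using y by (simp only: hermitian_comp_def mat_range_def) blast
  then have "(\<Sum>i\<in>UNIV. cnj (B $ i $ j) * y $ i) = 0" for j
    by (simp only: matrix_vector_mult_axis)
  then show "y \<in> mat_null (conj_transpose B)"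
    by (simp add: mat_null_iff vec_eq_iff
        conj_transpose_def transpose_def map_matrix_def matrix_vector_mult_def)
next
  fix y assume "y \<in> mat_null (conj_transpose B)"
  then have y: "(\<Sum>i\<in>UNIV. cnj (B $ i $ j) * y $ i) = 0" for j
    by (simp add: mat_null_iff vec_eq_iff
        conj_transpose_def transpose_def map_matrix_def matrix_vector_mult_def)
  have "(\<Sum>i\<in>UNIV. cnj ((B *v z) $ i) * y $ i) = 0" for z
  proof -
    have "(\<Sum>i\<in>UNIV. cnj ((B *v z) $ i) * y $ i)
        = (\<Sum>i\<in>UNIV. \<Sum>j\<in>UNIV. cnj (z $ j) * (cnj (B $ i $ j) * y $ i))"
      by (simp add: matrix_vector_mult_def sum_distrib_right sum_distrib_left mult_ac)
    also have "\<dots> = (\<Sum>j\<in>UNIV. cnj (z $ j) * (\<Sum>i\<in>UNIV. cnj (B $ i $ j) * y $ i))"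
      by (subst sum.swap) (simp add: sum_distrib_left)
    finally show ?thesis by (simp add: y)
  qed
  then show "y \<in> hermitian_comp (mat_range B)"
    by (auto simp: hermitian_comp_def mat_range_def)
qed

text \<open>The real inner product of \<open>z\<close> and \<open>x\<close> is the real part of their Hermitian product, and the one of
  \<open>z\<close> and \<open>\<i> x\<close> is its imaginary part. On a complex subspace real orthogonality therefore implies
  Hermitian orthogonality, and the orthogonal decomposition of a real Euclidean space carries
  over.\<close>

lemma hermitian_comp_if_orthogonal:
  assumes T: "vec.subspace T" and orth: "\<And>w. w \<in> T \<Longrightarrow> orthogonal z w"
  shows "z \<in> hermitian_comp T"
  unfolding hermitian_comp_def
proof (intro CollectI ballI)
  fix x assume x: "x \<in> T"
  let ?h = "\<Sum>i\<in>UNIV. cnj (x $ i) * z $ i"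
  have "Re ?h = z \<bullet> x"
    by (simp add: inner_vec_def inner_complex_def algebra_simps)
  moreover have "Im ?h = z \<bullet> (\<i> *s x)"
    by (simp add: inner_vec_def inner_complex_def algebra_simps)
  moreover have "\<i> *s x \<in> T" using T x by (rule vec.subspace_scale)
  ultimately show "?h = 0"
    using orth x by (simp add: orthogonal_def complex_eq_iff)
qed

lemma direct_sum_hermitian_comp:
  fixes B :: "complex^'n^'p"
  shows "direct_sum_decomp (mat_range B) (hermitian_comp (mat_range B))"
proof -
  let ?T = "mat_range B"
  have T: "vec.subspace ?T" by (rule subspace_mat_range)
  have scale: "r *\<^sub>R x = complex_of_real r *s x" for r and x :: "complex^'p"
    by (simp add: vec_eq_iff scaleR_conv_of_real[symmetric])
  have real: "subspace ?T"
    using T unfolding subspace_def vec.subspace_def by (simp add: scale)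
  have "x \<in> {t + s |t s. t \<in> ?T \<and> s \<in> hermitian_comp ?T}" for x
  proof -
    obtain t s where "t \<in> span ?T" "\<And>w. w \<in> span ?T \<Longrightarrow> orthogonal s w" "x = t + s"
      using orthogonal_subspace_decomp_exists by blast
    moreover have "span ?T = ?T" using real by (simp add: span_eq_iff)
    ultimately show ?thesis using hermitian_comp_if_orthogonal[OF T] by blast
  qed
  moreover have "x = 0" if "x \<in> ?T" "x \<in> hermitian_comp ?T" for x
  proof -
    have "(\<Sum>i\<in>UNIV. cnj (x $ i) * x $ i) = 0"
      using that by (simp add: hermitian_comp_def)
    then have "complex_of_real (\<Sum>i\<in>UNIV. (cmod (x $ i))\<^sup>2) = 0"
      by (simp only: of_real_sum complex_norm_square mult.commute)
    then have "(\<Sum>i\<in>UNIV. (cmod (x $ i))\<^sup>2) = 0" by (simp only: of_real_eq_0_iff)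
    then show ?thesis by (simp add: sum_nonneg_eq_0_iff vec_eq_iff)
  qed
  moreover have "0 \<in> ?T \<inter> hermitian_comp ?T"
    using T vec.subspace_0 by (auto simp: hermitian_comp_def)
  moreover have "vec.subspace (hermitian_comp ?T)"
    by (simp add: hermitian_comp_mat_range subspace_mat_null)
  ultimately show ?thesis
    unfolding direct_sum_decomp_def using T by auto
qed

lemma orth_projector_mat_range:
  fixes B :: "complex^'n^'p"
  shows orth_projector_in: "orth_projector (mat_range B) *v x \<in> mat_range B"
    and orth_projector_fixes: "x \<in> mat_range B \<Longrightarrow> orth_projector (mat_range B) *v x = x"
    and orth_projector_null:
      "orth_projector (mat_range B) *v x = 0 \<longleftrightarrow> conj_transpose B *v x = 0"
proof -
  note ds = direct_sum_hermitian_comp[of B]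
  note add = projector_add[OF ds, folded orth_projector_def]
  have sub: "0 \<in> mat_range B" "0 \<in> hermitian_comp (mat_range B)"
    using ds by (auto simp: direct_sum_decomp_def vec.subspace_0)
  obtain t s where ts: "t \<in> mat_range B" "s \<in> hermitian_comp (mat_range B)" "x = t + s"
    using direct_sum_decompE[OF ds] by blast
  show "orth_projector (mat_range B) *v x \<in> mat_range B"
    using add ts by simp
  show "orth_projector (mat_range B) *v x = x" if "x \<in> mat_range B"
    using add[OF that sub(2)] by simp
  show "orth_projector (mat_range B) *v x = 0 \<longleftrightarrow> conj_transpose B *v x = 0"
    using add[OF ts(1,2)] add[OF sub(1)] ts
    by (auto simp: hermitian_comp_mat_range mat_null_iff matrix_vector_right_distrib)
qed

section \<open>The weighted core-EP inverse\<close>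

lemma weight_maps_range:
  assumes "x \<in> mat_range (mat_pow (A ** W) k)"
  shows "W *v x \<in> mat_range (mat_pow (W ** A) k)"
proof -
  obtain y where "x = mat_pow (A ** W) k *v y" using assms by (auto simp: mat_range_iff)
  then have "W *v x = mat_pow (W ** A) k *v (W *v y)"
    by (simp add: matrix_vector_mul_assoc mat_pow_slide)
  then show ?thesis by (auto simp: mat_range_iff)
qed

text \<open>If \<open>W\<close> kills \<open>x\<close>, so does \<open>A ** W\<close>, which is injective on this range.\<close>

lemma weight_injective:
  assumes "mat_index (A ** W) \<le> k" "x \<in> mat_range (mat_pow (A ** W) k)" "W *v x = 0"
  shows "x = 0"
proof (rule index_injective[OF assms(1,2)])
  show "(A ** W) *v x = 0" using assms(3) by (simp flip: matrix_vector_mul_assoc)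
qed

text \<open>Since the range of \<open>M\<^sup>k\<close> for \<open>M = W ** A\<close> is also that of \<open>M\<^sup>k\<^sup>+\<^sup>2\<close>, the orthogonal projector
  factors as \<open>M\<^sup>k\<^sup>+\<^sup>2 D\<close>. As \<open>M\<^sup>k\<^sup>+\<^sup>2 = W A W (A W)\<^sup>k A\<close>, a solution can be read off.\<close>

lemma weighted_core_EP_exists:
  assumes "mat_index (W ** A) \<le> k"
  obtains X where "W ** A ** W ** X = orth_projector (mat_range (mat_pow (W ** A) k))"
    and "mat_range X \<subseteq> mat_range (mat_pow (A ** W) k)"
proof -
  let ?P = "orth_projector (mat_range (mat_pow (W ** A) k))"
  have "mat_range ?P \<subseteq> mat_range (mat_pow (W ** A) (2 + k))"
    using orth_projector_in[of "mat_pow (W ** A) k"] mat_range_pow_shift[OF assms, of 2]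
    by (auto simp: mat_range_iff)
  then obtain D where D: "?P = mat_pow (W ** A) (2 + k) ** D"
    by (rule matrix_mult_factor)
  let ?X = "mat_pow (A ** W) k ** A ** D"
  have "mat_pow (W ** A) (2 + k) = W ** A ** W ** (A ** mat_pow (W ** A) k)"
    by (simp add: numeral_2_eq_2 matrix_mul_assoc)
  then have "W ** A ** W ** ?X = ?P"
    unfolding D by (simp add: mat_pow_slide matrix_mul_assoc)
  moreover have "mat_range ?X \<subseteq> mat_range (mat_pow (A ** W) k)"
    by (auto simp: mat_range_def simp flip: matrix_vector_mul_assoc)
  ultimately show thesis by (rule that)
qed

text \<open>This makes the weighted core-EP inverse unique: the difference of two solutions has its columns in
  the range of the power of \<open>A ** W\<close> and is killed by \<open>W ** A ** W\<close>.\<close>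

lemma core_equation_injective:
  assumes "mat_index (A ** W) \<le> k" "x \<in> mat_range (mat_pow (A ** W) k)"
    and "(W ** A ** W) *v x = 0"
  shows "x = 0"
proof (rule index_injective[OF assms(1,2)], rule weight_injective[OF assms(1)])
  show "(A ** W) *v x \<in> mat_range (mat_pow (A ** W) k)"
    using assms(2) by (rule mult_mat_range_pow)
  show "W *v ((A ** W) *v x) = 0"
    using assms(3) by (simp add: matrix_vector_mul_assoc matrix_mul_assoc)
qed

lemma weighted_core_EP_properties:
  fixes W :: "complex^'q^'n" and A :: "complex^'n^'q"
  defines "k \<equiv> windex W A"
  shows core_EP_equation:
      "W ** A ** W ** weighted_core_EP W A = orth_projector (mat_range (mat_pow (W ** A) k))"
    and core_EP_range: "mat_range (weighted_core_EP W A) \<subseteq> mat_range (mat_pow (A ** W) k)"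
proof -
  have ind: "mat_index (A ** W) \<le> k" "mat_index (W ** A) \<le> k"
    by (simp_all add: k_def windex_def)
  let ?R = "mat_range (mat_pow (A ** W) k)"
  let ?E = "\<lambda>X. W ** A ** W ** X = orth_projector (mat_range (mat_pow (W ** A) k)) \<and>
     mat_range X \<subseteq> ?R"
  have "Y = X" if X: "?E X" and Y: "?E Y" for X Y
  proof -
    have "Y *v x = X *v x" for x
    proof -
      have "Y *v x - X *v x \<in> ?R"
        using X Y by (intro vec.subspace_diff subspace_mat_range) (auto simp: mat_range_def)
      moreover have "(W ** A ** W) *v (Y *v x - X *v x) = 0"
        using X Y by (simp add: matrix_vector_mult_diff_distrib matrix_vector_mul_assoc)
      ultimately have "Y *v x - X *v x = 0" by (rule core_equation_injective[OF ind(1)])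
      then show ?thesis by simp
    qed
    then show ?thesis by (simp add: matrix_eq)
  qed
  then have "\<exists>!X. ?E X" using weighted_core_EP_exists[OF ind(2)] by metis
  then have "?E (THE X. ?E X)" by (rule theI')
  then show "W ** A ** W ** weighted_core_EP W A = orth_projector (mat_range (mat_pow (W ** A) k))"
    and "mat_range (weighted_core_EP W A) \<subseteq> ?R"
    unfolding weighted_core_EP_def k_def by auto
qed

text \<open>Write \<open>N = A ** W\<close> and \<open>P\<close> for the orthogonal projector in the defining equation, so that
  \<open>W N V = P W\<close>. For \<open>x\<close> in the range of \<open>N\<^sup>k\<close> the projector fixes \<open>W x\<close>, and cancelling
  the injective \<open>W\<close> gives \<open>N V x = x\<close>; cancelling \<open>N\<close> in \<open>N V N x = N x\<close> then gives
  \<open>V N x = x\<close>. Since \<open>W N\<close> is injective on the values of \<open>V\<close>, the null space of \<open>V\<close> is that of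
  \<open>P W\<close>, and \<open>P\<close> has the null space of the conjugate transpose of \<open>(W ** A)\<^sup>k\<close>.\<close>

lemma core_EP_weight:
  fixes W :: "complex^'q^'n" and A :: "complex^'n^'q"
  defines "V \<equiv> weighted_core_EP W A ** W" and "k \<equiv> windex W A"
  shows core_EP_weight_in: "V *v x \<in> mat_range (mat_pow (A ** W) k)"
    and core_EP_weight_right:
      "x \<in> mat_range (mat_pow (A ** W) k) \<Longrightarrow> (A ** W) *v (V *v x) = x"
    and core_EP_weight_left:
      "x \<in> mat_range (mat_pow (A ** W) k) \<Longrightarrow> V *v ((A ** W) *v x) = x"
    and core_EP_weight_null:
      "V *v x = 0 \<longleftrightarrow> conj_transpose (mat_pow (W ** A) k) *v (W *v x) = 0"
proof -
  let ?R = "mat_range (mat_pow (A ** W) k)"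
  let ?P = "orth_projector (mat_range (mat_pow (W ** A) k))"
  have ind: "mat_index (A ** W) \<le> k" by (simp add: k_def windex_def)
  have sub: "vec.subspace ?R" by (rule subspace_mat_range)
  have V_in: "V *v x \<in> ?R" for x
    using core_EP_range[of W A] unfolding V_def k_def
    by (auto simp: mat_range_def simp flip: matrix_vector_mul_assoc)
  then show "V *v x \<in> ?R" .
  have WNV: "W *v ((A ** W) *v (V *v x)) = ?P *v (W *v x)" for x
    using core_EP_equation[of W A] unfolding V_def k_def
    by (simp add: matrix_vector_mul_assoc matrix_mul_assoc)
  have right: "(A ** W) *v (V *v x) = x" if x: "x \<in> ?R" for x
  proof -
    have "(A ** W) *v (V *v x) - x \<in> ?R"
      by (intro vec.subspace_diff[OF sub] mult_mat_range_pow V_in x)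
    moreover have "W *v ((A ** W) *v (V *v x) - x) = 0"
      using WNV orth_projector_fixes[OF weight_maps_range[OF x]]
      by (simp add: matrix_vector_mult_diff_distrib)
    ultimately have "(A ** W) *v (V *v x) - x = 0" by (rule weight_injective[OF ind])
    then show ?thesis by simp
  qed
  then show "x \<in> ?R \<Longrightarrow> (A ** W) *v (V *v x) = x" .
  show "V *v ((A ** W) *v x) = x" if x: "x \<in> ?R"
  proof -
    have "V *v ((A ** W) *v x) - x \<in> ?R"
      by (intro vec.subspace_diff[OF sub] V_in x)
    moreover have "(A ** W) *v (V *v ((A ** W) *v x) - x) = 0"
      using right[OF mult_mat_range_pow[OF x]] by (simp add: matrix_vector_mult_diff_distrib)
    ultimately have "V *v ((A ** W) *v x) - x = 0" by (rule index_injective[OF ind])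
    then show ?thesis by simp
  qed
  have "V *v x = 0 \<longleftrightarrow> (W ** A ** W) *v (V *v x) = 0"
    using core_equation_injective[OF ind V_in] by auto
  also have "\<dots> \<longleftrightarrow> ?P *v (W *v x) = 0"
    using WNV by (simp add: matrix_vector_mul_assoc matrix_mul_assoc)
  finally show "V *v x = 0 \<longleftrightarrow> conj_transpose (mat_pow (W ** A) k) *v (W *v x) = 0"
    by (simp add: orth_projector_null)
qed

section \<open>The weighted weak group inverse\<close>

text \<open>Multiplying by the weight on the right turns the powers of the weighted product into ordinary
  matrix powers.\<close>

lemma wpow_mult_weight: "wpow W X (Suc l) ** W = mat_pow (X ** W) (Suc l)"
proof (induction l)
  case (Suc l)
  have "wpow W X (Suc (Suc l)) = X ** W ** wpow W X (Suc l)"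
    by (simp add: wpow_def wprod_def)
  then have "wpow W X (Suc (Suc l)) ** W = X ** W ** (wpow W X (Suc l) ** W)"
    by (simp add: matrix_mul_assoc)
  then show ?case by (simp add: Suc)
qed (simp add: wpow_def)

lemma weighted_weak_group_mult_weight:
  assumes "m \<ge> 1"
  shows "weighted_weak_group W m A ** W =
    mat_pow (weighted_core_EP W A ** W) (Suc m) ** mat_pow (A ** W) m"
proof -
  obtain l where m: "m = Suc l" using assms by (cases m) auto
  have "weighted_weak_group W m A ** W =
      (wpow W (weighted_core_EP W A) (Suc m) ** W) ** (wpow W A m ** W)"
    by (simp add: weighted_weak_group_def matrix_mul_assoc)
  then show ?thesis by (simp only: wpow_mult_weight m)
qed

lemma mat_pow_left_inverse_on:
  assumes "\<And>x. x \<in> T \<Longrightarrow> B *v x \<in> T" and "\<And>x. x \<in> T \<Longrightarrow> V *v (B *v x) = x" and "x \<in> T"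
  shows "(mat_pow V m ** mat_pow B m) *v x = x"
  using assms(3)
proof (induction m arbitrary: x)
  case (Suc m)
  have "(mat_pow V (Suc m) ** mat_pow B (Suc m)) *v x
      = V *v ((mat_pow V m ** mat_pow B m) *v (B *v x))"
    by (simp add: mat_pow_Suc2[of B] matrix_vector_mul_assoc matrix_mul_assoc del: mat_pow.simps)
       (simp add: matrix_mul_assoc)
  then show ?case using Suc assms by simp
qed simp

text \<open>After one application of \<open>V\<close> the vector lies in the range on which \<open>V\<close> is injective, so further
  applications do not enlarge the null space.\<close>

lemma core_EP_weight_pow:
  fixes W :: "complex^'q^'n" and A :: "complex^'n^'q"
  defines "V \<equiv> weighted_core_EP W A ** W" and "k \<equiv> windex W A"
  shows core_EP_weight_pow_in:
      "m \<ge> 1 \<Longrightarrow> mat_pow V m *v x \<in> mat_range (mat_pow (A ** W) k)"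
    and core_EP_weight_pow_null:
      "m \<ge> 1 \<Longrightarrow> mat_pow V m *v x = 0 \<longleftrightarrow> V *v x = 0"
proof -
  note right = core_EP_weight_right[where W=W and A=A, folded V_def k_def]
  note V_in = core_EP_weight_in[where W=W and A=A, folded V_def k_def]
  show "mat_pow V m *v x \<in> mat_range (mat_pow (A ** W) k)" if "m \<ge> 1"
  proof -
    obtain l where m: "m = Suc l" using \<open>m \<ge> 1\<close> by (cases m) auto
    show ?thesis using V_in[of "mat_pow V l *v x"] by (simp add: m matrix_vector_mul_assoc)
  qed
  show "mat_pow V m *v x = 0 \<longleftrightarrow> V *v x = 0" if "m \<ge> 1"
    using that
  proof (induction m arbitrary: x rule: nat_induct_at_least)
    case (Suc m)
    have "mat_pow V (Suc m) *v x = mat_pow V m *v (V *v x)"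
      unfolding mat_pow_Suc2 by (simp add: matrix_vector_mul_assoc)
    moreover have "V *v (V *v x) = 0 \<longleftrightarrow> V *v x = 0"
      using right[OF V_in, of x] by (metis matrix_vector_mult_0_right)
    ultimately show ?case using Suc.IH[of "V *v x"] by simp
  qed simp
qed

theorem theorem3p1:
  fixes A :: "complex^'n^'q" and W :: "complex^'q^'n" and m k :: nat
  assumes "W \<noteq> 0" and "m \<ge> 1"
    and "k = max (mat_index (A ** W)) (mat_index (W ** A))"
  shows "(direct_sum_decomp (mat_range (mat_pow (A ** W) k))
       (mat_null (conj_transpose (mat_pow (W ** A) k) ** W ** mat_pow (A ** W) m)) \<and>
     A ** W ** weighted_weak_group W m A ** W =
       projector (mat_range (mat_pow (A ** W) k))
         (mat_null (conj_transpose (mat_pow (W ** A) k) ** W ** mat_pow (A ** W) m))) \<and>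
    (direct_sum_decomp (mat_range (mat_pow (W ** A) k))
       (mat_null (conj_transpose (mat_pow (W ** A) k) ** mat_pow (W ** A) (m + 1))) \<and>
     W ** weighted_weak_group W m A ** W ** A =
       projector (mat_range (mat_pow (W ** A) k))
         (mat_null (conj_transpose (mat_pow (W ** A) k) ** mat_pow (W ** A) (m + 1))))"
proof -
  define V where "V = weighted_core_EP W A ** W"
  define N where "N = A ** W"
  define M where "M = W ** A"
  have k: "k = windex W A" using assms(3) by (simp add: windex_def)
  let ?T = "mat_range (mat_pow N k)"
  let ?S = "mat_range (mat_pow M k)"
  let ?C = "conj_transpose (mat_pow M k)"
  have ind: "mat_index N \<le> k" "mat_index M \<le> k"
    using assms(3) by (simp_all add: N_def M_def)
  note V_in = core_EP_weight_in[where W=W and A=A, folded V_def N_def M_def k]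
    and V_right = core_EP_weight_right[where W=W and A=A, folded V_def N_def M_def k]
    and V_left = core_EP_weight_left[where W=W and A=A, folded V_def N_def M_def k]
    and V_null = core_EP_weight_null[where W=W and A=A, folded V_def N_def M_def k]
    and V_pow_in = core_EP_weight_pow_in[where W=W and A=A, folded V_def N_def M_def k]
    and V_pow_null = core_EP_weight_pow_null[where W=W and A=A, folded V_def N_def M_def k]
  have N_T: "N *v x \<in> ?T" if "x \<in> ?T" for x using that by (rule mult_mat_range_pow)
  have W_T: "W *v x \<in> ?S" if "x \<in> ?T" for x
    using that weight_maps_range[of x A W k] by (simp add: N_def M_def)
  have A_S: "A *v x \<in> ?T" if "x \<in> ?S" for x
    using that weight_maps_range[of x W A k] by (simp add: N_def M_def)
  have W_0: "x = 0" if "x \<in> ?T" "W *v x = 0" for x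
    using that ind weight_injective[of A W k x] by (simp add: N_def)
  have A_0: "x = 0" if "x \<in> ?S" "A *v x = 0" for x
    using that ind weight_injective[of W A k x] by (simp add: M_def)
  have VN: "mat_pow V m *v (mat_pow N m *v x) = x" if "x \<in> ?T" for x
    using mat_pow_left_inverse_on[of ?T N V x m] N_T V_left that
    by (simp add: matrix_vector_mul_assoc)
  have wg: "weighted_weak_group W m A ** W = mat_pow V (Suc m) ** mat_pow N m"
    using weighted_weak_group_mult_weight[OF assms(2)] by (simp add: V_def N_def)

  define Q1 where "Q1 = A ** W ** weighted_weak_group W m A ** W"
  have Q1: "Q1 *v x = mat_pow V m *v (mat_pow N m *v x)" for x
  proof -
    have "Q1 = N ** V ** mat_pow V m ** mat_pow N m"
      using wg by (simp add: Q1_def N_def flip: matrix_mul_assoc)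
    then have "Q1 *v x = N *v (V *v (mat_pow V m *v (mat_pow N m *v x)))"
      by (simp add: matrix_vector_mul_assoc matrix_mul_assoc)
    then show ?thesis using V_right V_pow_in[OF assms(2)] by simp
  qed
  have "Q1 *v x = 0 \<longleftrightarrow> ?C *v (W *v (mat_pow N m *v x)) = 0" for x
    unfolding Q1 V_pow_null[OF assms(2)] by (rule V_null)
  then have "mat_null Q1 = mat_null (?C ** W ** mat_pow N m)"
    by (auto simp: mat_null_iff simp flip: matrix_vector_mul_assoc)
  moreover have "direct_sum_decomp ?T (mat_null Q1) \<and> Q1 = projector ?T (mat_null Q1)"
    by (rule projector_if_retraction) (use V_pow_in[OF assms(2)] VN in \<open>auto simp: Q1\<close>)
  ultimately have part1: "direct_sum_decomp ?T (mat_null (?C ** W ** mat_pow N m)) \<and>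
      Q1 = projector ?T (mat_null (?C ** W ** mat_pow N m))"
    by simp

  define Q2 where "Q2 = W ** weighted_weak_group W m A ** W ** A"
  have Q2: "Q2 *v x = W *v (V *v (mat_pow V m *v (mat_pow N m *v (A *v x))))" for x
  proof -
    have "Q2 = W ** (weighted_weak_group W m A ** W) ** A"
      by (simp add: Q2_def matrix_mul_assoc)
    then show ?thesis unfolding wg by (simp add: matrix_vector_mul_assoc matrix_mul_assoc)
  qed
  have in_S: "Q2 *v x \<in> ?S" for x
    unfolding Q2 by (intro W_T V_in)
  \<comment> \<open>\<open>A\<close> maps \<open>W V A x\<close> and \<open>x\<close> to the same vector because \<open>N V\<close> fixes \<open>A x\<close>, and it is
    injective on \<open>?S\<close>.\<close>
  have fix_S: "Q2 *v x = x" if x: "x \<in> ?S" for x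
  proof -
    have "A *v (W *v (V *v (A *v x))) = A *v x"
      using V_right[OF A_S[OF x]] by (simp add: N_def matrix_vector_mul_assoc matrix_mul_assoc)
    then have "A *v (W *v (V *v (A *v x)) - x) = 0"
      by (simp add: matrix_vector_mult_diff_distrib)
    moreover have "W *v (V *v (A *v x)) - x \<in> ?S"
      by (intro vec.subspace_diff[OF subspace_mat_range] W_T V_in x)
    ultimately have "W *v (V *v (A *v x)) = x" using A_0 by force
    then show ?thesis by (simp add: Q2 VN[OF A_S[OF x]])
  qed
  have null_Q2: "mat_null Q2 = mat_null (?C ** mat_pow M (m + 1))"
  proof -
    have "W ** mat_pow N m ** A = W ** (A ** mat_pow M m)"
      unfolding N_def M_def by (simp add: mat_pow_slide flip: matrix_mul_assoc)
    then have WNA: "W ** mat_pow N m ** A = mat_pow M (m + 1)"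
      by (simp add: M_def matrix_mul_assoc)
    have "Q2 *v x = 0 \<longleftrightarrow> ?C *v (mat_pow M (m + 1) *v x) = 0" for x
    proof -
      let ?y = "mat_pow N m *v (A *v x)"
      have "Q2 *v x = 0 \<longleftrightarrow> V *v (mat_pow V m *v ?y) = 0"
        unfolding Q2 using W_0[OF V_in] by auto
      also have "\<dots> \<longleftrightarrow> V *v ?y = 0"
        using V_pow_null[of "Suc m" ?y] by (simp flip: matrix_vector_mul_assoc)
      also have "\<dots> \<longleftrightarrow> ?C *v ((W ** mat_pow N m ** A) *v x) = 0"
        by (simp add: V_null flip: matrix_vector_mul_assoc)
      finally show ?thesis unfolding WNA .
    qed
    then show ?thesis by (auto simp: mat_null_iff simp flip: matrix_vector_mul_assoc)
  qed
  have "direct_sum_decomp ?S (mat_null Q2) \<and> Q2 = projector ?S (mat_null Q2)"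
    by (rule projector_if_retraction) (use in_S fix_S in auto)
  then have "direct_sum_decomp ?S (mat_null (?C ** mat_pow M (m + 1))) \<and>
      Q2 = projector ?S (mat_null (?C ** mat_pow M (m + 1)))"
    by (simp only: null_Q2)
  with part1 show ?thesis
    unfolding Q1_def Q2_def N_def M_def by blast
qed

end
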